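(* There is an absolute constant $c>0$ such that for every integer $m\ge 2$ and every convex digital polygon $\Gamma$ contained in an $m\times m$ grid (i.e. $\Gamma\subset\{0,\dots,m\}^2$ up to translation) with $n_e(\Gamma)\ge 1$ edges, \[ \min_{l}\mathcal{L}^1(MS_l)\;\le\; c\,\log m\,\frac{\mathrm{Per}(\Gamma)}{n_e(\Gamma)}, \] where the minimum ranges over all maximal segments $MS_l$ of the contour of $\Gamma$.
   Context: A standard line with slope $a/b$ and shift $\mu$ ($a,b,\mu\in\mathbb{Z}$) is the set of $(x,y)\in\mathbb{Z}^2$ with $\mu\le ax-by<\mu+|a|+|b|$. A convex digital polygon (CDP) is a finite $\Gamma\subset\mathbb{Z}^2$ with $\Gamma=\mathrm{Conv}(\Gamma)\cap\mathbb{Z}^2$. Its vertices $V_1,\dots,V_e$ (cyclically ordered) form the minimal subset with $\Gamma=\mathrm{Conv}(V_1,\dots,V_e)\cap\mathbb{Z}^2$, and $n_e(\Gamma)=e$ is its number of vertices (equivalently of edges). Its boundary points form a closed 4-connected digital curve (the contour) passing through the vertices in cyclic order; the digital edge $[V_kV_{k+1}]$ is the portion of the contour from $V_k$ to $V_{k+1}$. A set of consecutive contour points is a digital straight segment (DSS) if it is contained in some standard line; a maximal segment is a DSS $P_i,\dots,P_j$ such that neither $P_{i-1},\dots,P_j$ nor $P_i,\dots,P_{j+1}$ is a DSS. $\mathcal{L}^1$ denotes city-block length (number of unit steps) of a set of consecutive contour points, and $\mathrm{Per}(\Gamma)$ is the sum of the $\mathcal{L}^1$-lengths of its digital edges. 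*)

theory Defs
  imports "HOL-Analysis.Analysis"
begin

type_synonym pt = "int \<times> int"

definition emb :: "pt \<Rightarrow> real \<times> real" where
  "emb p = (real_of_int (fst p), real_of_int (snd p))"

definition cdp :: "pt set \<Rightarrow> bool" where
  "cdp G \<longleftrightarrow> finite G \<and> G = {p. emb p \<in> convex hull (emb ` G)}"

text \<open>Vertices: lattice points that are extreme points of the convex hull
  (the unique minimal subset generating G).\<close>
definition cdp_vertices :: "pt set \<Rightarrow> pt set" where
  "cdp_vertices G = {p \<in> G. emb p extreme_point_of (convex hull (emb ` G))}"

definition n_e :: "pt set \<Rightarrow> nat" where
  "n_e G = card (cdp_vertices G)"

definition l1dist :: "pt \<Rightarrow> pt \<Rightarrow> int" where
  "l1dist p q = \<bar>fst p - fst q\<bar> + \<bar>snd p - snd q\<bar>"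

definition adj4 :: "pt \<Rightarrow> pt \<Rightarrow> bool" where
  "adj4 p q \<longleftrightarrow> l1dist p q = 1"

definition boundary_pts :: "pt set \<Rightarrow> pt set" where
  "boundary_pts G = {p \<in> G. \<exists>q. q \<notin> G \<and> max \<bar>fst q - fst p\<bar> \<bar>snd q - snd p\<bar> = 1}"

definition cross :: "pt \<Rightarrow> pt \<Rightarrow> pt \<Rightarrow> int" where
  "cross a b p = (fst b - fst a) * (snd p - snd a) - (snd b - snd a) * (fst p - fst a)"

text \<open>Contour data: P is the N-periodic (closed) 4-connected walk, indexed by integers,
  visiting exactly the boundary points; V enumerates the e vertices in cyclic order;
  t k is the index at which the contour passes through V k (t e = t 0 + N closes the cycle);
  the digital edge from V k to V (k+1) is the portion P (t k), ..., P (t (k+1)).\<close>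
definition is_contour ::
  "pt set \<Rightarrow> (int \<Rightarrow> pt) \<Rightarrow> nat \<Rightarrow> (nat \<Rightarrow> pt) \<Rightarrow> (nat \<Rightarrow> int) \<Rightarrow> bool" where
  "is_contour G P N V t \<longleftrightarrow>
     (let e = n_e G in
       N > 0 \<and> (\<forall>i. P (i + int N) = P i) \<and> (\<forall>i. adj4 (P i) (P (i + 1))) \<and>
       P ` {0..<int N} = boundary_pts G \<and>
       bij_betw V {..<e} (cdp_vertices G) \<and>
       ((\<forall>k<e. \<forall>p\<in>G. cross (V k) (V (Suc k mod e)) p \<ge> 0) \<or>
        (\<forall>k<e. \<forall>p\<in>G. cross (V k) (V (Suc k mod e)) p \<le> 0)) \<and>
       t e = t 0 + int N \<and> (\<forall>k<e. t k < t (Suc k)) \<and>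
       (\<forall>k\<le>e. P (t k) = V (k mod e)) \<and>
       (\<forall>k<e. t (Suc k) - t k = l1dist (V k) (V (Suc k mod e))))"

text \<open>Perimeter: sum of the city-block lengths of the digital edges.\<close>
definition per_contour :: "nat \<Rightarrow> (nat \<Rightarrow> int) \<Rightarrow> int" where
  "per_contour e t = (\<Sum>k<e. t (Suc k) - t k)"

definition standard_line :: "int \<Rightarrow> int \<Rightarrow> int \<Rightarrow> pt set" where
  "standard_line a b \<mu> = {(x, y). \<mu> \<le> a * x - b * y \<and> a * x - b * y < \<mu> + \<bar>a\<bar> + \<bar>b\<bar>}"

text \<open>A set of consecutive contour points P i, ..., P j (at most N points, i.e. at most
  the whole closed curve) that lies in some standard line.\<close>
definition is_DSS :: "(int \<Rightarrow> pt) \<Rightarrow> nat \<Rightarrow> int \<Rightarrow> int \<Rightarrow> bool" where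
  "is_DSS P N i j \<longleftrightarrow> i \<le> j \<and> j - i < int N \<and>
     (\<exists>a b \<mu>. P ` {i..j} \<subseteq> standard_line a b \<mu>)"

definition is_maximal_segment :: "(int \<Rightarrow> pt) \<Rightarrow> nat \<Rightarrow> int \<Rightarrow> int \<Rightarrow> bool" where
  "is_maximal_segment P N i j \<longleftrightarrow>
     is_DSS P N i j \<and> \<not> is_DSS P N (i - 1) j \<and> \<not> is_DSS P N i (j + 1)"

definition in_grid :: "nat \<Rightarrow> pt set \<Rightarrow> bool" where
  "in_grid m G \<longleftrightarrow> (\<exists>tx ty. \<forall>p\<in>G. 0 \<le> fst p - tx \<and> fst p - tx \<le> int m \<and>
                                     0 \<le> snd p - ty \<and> snd p - ty \<le> int m)"

end

theory Submission
  imports Defs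
begin

text \<open>
  Let \<open>L\<close> be the minimal length of a maximal segment. Extending greedily from any index \<open>x\<close>, two
  consecutive digital straight segments cover \<open>x, \<dots>, x + L\<close>: otherwise the second one, extended to
  the left, would be a maximal segment shorter than \<open>L\<close>. So the contour is covered by about \<open>2N/L\<close>
  digital straight segments, and it remains to see that each contains \<open>O(log m)\<close> vertices.

  A standard line meets every level of \<open>s = \<plusminus>x \<plusminus> y\<close> (signs of \<open>a\<close>, \<open>b\<close>) in exactly one point, hence a
  connected piece of it consists of all its points with \<open>s\<close> in some interval: it is the set
  of lattice points in a box for the coordinates \<open>s\<close> and \<open>h = ax - by\<close>. If \<open>v\<close> is a vertex, the
  reflection \<open>2v - w\<close> of any other point \<open>w\<close> must leave the box. For two vertices in the
  same quarter of the box, this forces the distance in \<open>s\<close> to the corner to more than double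
  from one to the other, so every quarter has \<open>O(log m)\<close> vertices.
\<close>

section \<open>Counting points in a box that no reflection keeps inside\<close>

text \<open>Removing the maximum \<open>b\<close> leaves elements of size at most
  \<open>(b - 1) div 2\<close>, so the range halves while the exponent drops by one. The factor 2
  leaves room for the element 0.\<close>

lemma two_power_card_le_if_doubling:
  fixes A :: "int set"
  assumes "finite A" "\<And>a. a \<in> A \<Longrightarrow> 0 \<le> a \<and> a \<le> n" "0 \<le> n"
    and "\<And>a b. a \<in> A \<Longrightarrow> b \<in> A \<Longrightarrow> a < b \<Longrightarrow> 2 * a < b"
  shows "(2::int) ^ card A \<le> 2 * (n + 1)"
  using assms
proof (induction A arbitrary: n rule: finite_linorder_max_induct)
  case empty
  then show ?case by simp
next
  case (insert b A)
  show ?case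
  proof (cases "A = {}")
    case True
    then show ?thesis using insert.prems by simp
  next
    case False
    then obtain a where a: "a \<in> A" by blast
    define n' where "n' = (b - 1) div 2"
    have "0 \<le> a \<and> 2 * a < b" using insert.prems(1,3) insert.hyps(2) a by auto
    then have n': "0 \<le> n'" "2 * n' \<le> b - 1" unfolding n'_def by linarith+
    have "c \<le> n'" if "c \<in> A" for c
    proof -
      have "2 * c < b" using insert.prems(3) insert.hyps(2) that by auto
      then show ?thesis unfolding n'_def by linarith
    qed
    then have "(2::int) ^ card A \<le> 2 * (n' + 1)"
      using insert.prems n'(1) by (intro insert.IH) auto
    moreover have "b \<notin> A" using insert.hyps(2) by blast
    moreover have "b \<le> n" using insert.prems(1) by blast
    ultimately show ?thesis using insert.hyps(1) n'(2) by simp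
  qed
qed

text \<open>Here \<open>s\<close> and \<open>h\<close> are distances to the sides at a corner. If
  \<open>s v \<le> s w\<close> and \<open>v \<noteq> w\<close>, reflecting \<open>v\<close> in
  \<open>w\<close> can only leave on the \<open>h\<close> side, so \<open>2 * h w < h v\<close>.
  Then reflecting \<open>w\<close> in \<open>v\<close> keeps \<open>h\<close> nonnegative and must
  leave on the \<open>s\<close> side: \<open>2 * s v < s w\<close>.\<close>

lemma two_power_card_le_quadrant:
  fixes s h :: "'a \<Rightarrow> int"
  assumes fin: "finite A" and n: "0 \<le> n"
    and s: "\<And>v. v \<in> A \<Longrightarrow> 0 \<le> s v \<and> s v \<le> n" and h: "\<And>v. v \<in> A \<Longrightarrow> 0 \<le> h v"
    and refl: "\<And>v w. v \<in> A \<Longrightarrow> w \<in> A \<Longrightarrow> 0 \<le> 2 * s v - s w \<Longrightarrow> 0 \<le> 2 * h v - h w \<Longrightarrow> v = w"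
  shows "(2::int) ^ card A \<le> 2 * (n + 1)"
proof -
  have dbl: "2 * s v < s w" if "v \<in> A" "w \<in> A" "v \<noteq> w" "s v \<le> s w" for v w
    using refl[of v w] refl[of w v] s[of v] s[of w] h[of v] h[of w] that by fastforce
  have "inj_on s A"
  proof (rule inj_onI, rule ccontr)
    fix v w assume "v \<in> A" "w \<in> A" "s v = s w" "v \<noteq> w"
    then show False using dbl[of v w] s[of v] by simp
  qed
  moreover have "(2::int) ^ card (s ` A) \<le> 2 * (n + 1)"
  proof (rule two_power_card_le_if_doubling)
    show "2 * a < b" if "a \<in> s ` A" "b \<in> s ` A" "a < b" for a b
      using that dbl by fastforce
  qed (use fin n s in auto)
  ultimately show ?thesis by (simp add: card_image)
qed

text \<open>For two points in the same quarter, a reflection cannot cross the two far sides of the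
  box: \<open>2 * s v \<le> lo + hi\<close> and \<open>lo \<le> s w\<close> give
  \<open>2 * s v - s w \<le> hi\<close>, and likewise for the others. So only the two sides at the
  corner matter.\<close>

lemma card_le_box:
  fixes s h :: "'a \<Rightarrow> int"
  assumes fin: "finite A" and lohi: "lo \<le> hi"
    and s: "\<And>v. v \<in> A \<Longrightarrow> lo \<le> s v \<and> s v \<le> hi" and h: "\<And>v. v \<in> A \<Longrightarrow> c \<le> h v \<and> h v \<le> d"
    and refl: "\<And>v w. v \<in> A \<Longrightarrow> w \<in> A \<Longrightarrow> lo \<le> 2 * s v - s w \<Longrightarrow> 2 * s v - s w \<le> hi
      \<Longrightarrow> c \<le> 2 * h v - h w \<Longrightarrow> 2 * h v - h w \<le> d \<Longrightarrow> v = w"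
  shows "real (card A) \<le> 4 * log 2 (real_of_int (2 * (hi - lo + 1)))"
proof -
  let ?n = "hi - lo"
  have log: "real k \<le> log 2 (real_of_int (2 * (?n + 1)))" if "(2::int) ^ k \<le> 2 * (?n + 1)" for k
  proof -
    have "(2::real) ^ k \<le> real_of_int (2 * (?n + 1))"
      using that by (metis of_int_le_iff of_int_numeral of_int_power)
    then have "log 2 (2 ^ k) \<le> log 2 (real_of_int (2 * (?n + 1)))"
      by (intro log_mono) auto
    then show ?thesis by simp
  qed
  define A1 where "A1 = {v \<in> A. 2 * s v \<le> lo + hi \<and> 2 * h v \<le> c + d}"
  define A2 where "A2 = {v \<in> A. 2 * s v \<le> lo + hi \<and> 2 * h v > c + d}"
  define A3 where "A3 = {v \<in> A. 2 * s v > lo + hi \<and> 2 * h v \<le> c + d}"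
  define A4 where "A4 = {v \<in> A. 2 * s v > lo + hi \<and> 2 * h v > c + d}"
  note defs = A1_def A2_def A3_def A4_def
  have 1: "(2::int) ^ card A1 \<le> 2 * (?n + 1)"
  proof (rule two_power_card_le_quadrant[where s = "\<lambda>v. s v - lo" and h = "\<lambda>v. h v - c"])
    show "v = w" if "v \<in> A1" "w \<in> A1" "0 \<le> 2 * (s v - lo) - (s w - lo)" "0 \<le> 2 * (h v - c) - (h w - c)" for v w
      using that s[of v] s[of w] h[of v] h[of w] by (intro refl) (auto simp: defs)
  qed (use fin lohi s h in \<open>auto simp: defs\<close>)
  have 2: "(2::int) ^ card A2 \<le> 2 * (?n + 1)"
  proof (rule two_power_card_le_quadrant[where s = "\<lambda>v. s v - lo" and h = "\<lambda>v. d - h v"])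
    show "v = w" if "v \<in> A2" "w \<in> A2" "0 \<le> 2 * (s v - lo) - (s w - lo)" "0 \<le> 2 * (d - h v) - (d - h w)" for v w
      using that s[of v] s[of w] h[of v] h[of w] by (intro refl) (auto simp: defs)
  qed (use fin lohi s h in \<open>auto simp: defs\<close>)
  have 3: "(2::int) ^ card A3 \<le> 2 * (?n + 1)"
  proof (rule two_power_card_le_quadrant[where s = "\<lambda>v. hi - s v" and h = "\<lambda>v. h v - c"])
    show "v = w" if "v \<in> A3" "w \<in> A3" "0 \<le> 2 * (hi - s v) - (hi - s w)" "0 \<le> 2 * (h v - c) - (h w - c)" for v w
      using that s[of v] s[of w] h[of v] h[of w] by (intro refl) (auto simp: defs)
  qed (use fin lohi s h in \<open>auto simp: defs\<close>)
  have 4: "(2::int) ^ card A4 \<le> 2 * (?n + 1)"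
  proof (rule two_power_card_le_quadrant[where s = "\<lambda>v. hi - s v" and h = "\<lambda>v. d - h v"])
    show "v = w" if "v \<in> A4" "w \<in> A4" "0 \<le> 2 * (hi - s v) - (hi - s w)" "0 \<le> 2 * (d - h v) - (d - h w)" for v w
      using that s[of v] s[of w] h[of v] h[of w] by (intro refl) (auto simp: defs)
  qed (use fin lohi s h in \<open>auto simp: defs\<close>)
  have "A = (A1 \<union> A2) \<union> (A3 \<union> A4)" unfolding defs by auto
  then have "card A \<le> (card A1 + card A2) + (card A3 + card A4)"
    using card_Un_le[of "A1 \<union> A2" "A3 \<union> A4"] card_Un_le[of A1 A2] card_Un_le[of A3 A4] by simp
  then show ?thesis using log[OF 1] log[OF 2] log[OF 3] log[OF 4] by linarith
qed

section \<open>Vertices on a digital straight segment\<close>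

lemma int_walk_intermediate_value:
  fixes f :: "int \<Rightarrow> int"
  assumes step: "\<And>k. \<bar>f (k + 1) - f k\<bar> \<le> 1"
    and "u \<in> {i..j}" "v \<in> {i..j}" "f u \<le> x" "x \<le> f v"
  shows "\<exists>k\<in>{i..j}. f k = x"
proof -
  have ivt: "\<exists>k\<in>{p..q}. g k = y"
    if "\<And>k. \<bar>g (k + 1) - g k\<bar> \<le> 1" "p \<le> q" "g p \<le> y" "y \<le> g q" for g :: "int \<Rightarrow> int" and p q y
  proof -
    let ?g = "\<lambda>n::nat. g (p + int n)"
    have "\<exists>n\<ge>0. n \<le> nat (q - p) \<and> ?g n = y"
    proof (rule nat_intermed_int_val)
      have "\<bar>?g (Suc n) - ?g n\<bar> \<le> 1" for n
        using that(1)[of "p + int n"] by (simp add: algebra_simps)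
      then show "\<forall>n. 0 \<le> n \<and> n < nat (q - p) \<longrightarrow> \<bar>?g (Suc n) - ?g n\<bar> \<le> 1" by blast
    qed (use that in auto)
    then obtain n where "n \<le> nat (q - p)" "?g n = y" by blast
    then show ?thesis using that(2) by (intro bexI[of _ "p + int n"]) auto
  qed
  show ?thesis
  proof (cases "u \<le> v")
    case True
    then obtain k where "k \<in> {u..v}" "f k = x" using ivt[of f u v x] assms by blast
    then show ?thesis using assms(2,3) by (intro bexI[of _ k]) auto
  next
    case False
    have "\<bar>- f (k + 1) - - f k\<bar> \<le> 1" for k using step[of k] by linarith
    then obtain k where "k \<in> {v..u}" "- f k = - x"
      using ivt[of "\<lambda>k. - f k" v u "- x"] assms False by fastforce
    then show ?thesis using assms(2,3) by (intro bexI[of _ k]) auto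
  qed
qed

text \<open>Otherwise \<open>v\<close> would be the midpoint of two distinct points of the hull,
  hence not extreme.\<close>

lemma cdp_vertex_reflection:
  assumes "v \<in> cdp_vertices G" "w \<in> G"
    and "(2 * fst v - fst w, 2 * snd v - snd w) \<in> G" (is "?u \<in> G")
  shows "v = w"
proof (rule ccontr)
  assume "v \<noteq> w"
  then have "emb w \<noteq> emb ?u" by (auto simp: emb_def prod_eq_iff)
  moreover have "emb v = midpoint (emb w) (emb ?u)"
    by (auto simp: emb_def midpoint_def algebra_simps)
  ultimately have "emb v \<in> open_segment (emb w) (emb ?u)"
    using midpoint_in_open_segment by metis
  moreover have "emb w \<in> convex hull (emb ` G)" "emb ?u \<in> convex hull (emb ` G)"
    using assms by (auto intro!: hull_inc)
  ultimately show False
    using assms(1) by (auto simp: cdp_vertices_def extreme_point_of_def)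
qed

lemma card_vertices_on_DSS:
  fixes P :: "int \<Rightarrow> pt"
  assumes adj: "\<And>k. adj4 (P k) (P (k + 1))"
    and PG: "\<And>k. P k \<in> G" and grid: "in_grid m G" and m: "m \<ge> 2"
    and line: "P ` {i..j} \<subseteq> standard_line a b \<mu>"
  shows "real (card (cdp_vertices G \<inter> P ` {i..j})) \<le> 16 * log 2 (real m)"
proof (cases "i \<le> j")
  case False
  then have "{i..j} = {}" by simp
  moreover have "0 \<le> log 2 (real m)" using m by simp
  ultimately show ?thesis by simp
next
  case True
  let ?S = "P ` {i..j}"
  \<comment> \<open>The signs give \<open>a * \<sigma> = \<bar>a\<bar>\<close> and
    \<open>b * \<tau> = \<bar>b\<bar>\<close>: a step by (\<sigma>, -\<tau>) preserves
    \<open>s\<close> and raises \<open>h\<close> by exactly \<bar>a\<bar> + \<bar>b\<bar>, the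
    number of values of \<open>h\<close> on the line.\<close>
  define \<sigma> :: int where "\<sigma> = (if a < 0 then -1 else 1)"
  define \<tau> :: int where "\<tau> = (if b < 0 then -1 else 1)"
  define s where "s p = \<sigma> * fst p + \<tau> * snd p" for p :: pt
  define h where "h p = a * fst p - b * snd p" for p :: pt
  let ?d = "\<mu> + \<bar>a\<bar> + \<bar>b\<bar> - 1"
  have h: "\<mu> \<le> h p \<and> h p \<le> ?d" if "p \<in> ?S" for p
    using line that by (fastforce simp: standard_line_def h_def)
  have determined: "p = q" if "s p = s q" "\<mu> \<le> h p" "h p \<le> ?d" "\<mu> \<le> h q" "h q \<le> ?d" for p q
  proof -
    \<comment> \<open>\<open>k\<close> counts the steps (\<sigma>, -\<tau>) from \<open>q\<close> to
      \<open>p\<close>. The bounds on \<open>h\<close> also exclude \<open>a = b = 0\<close>, so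
      dividing by \<bar>a\<bar> + \<bar>b\<bar> is sound.\<close>
    define k where "k = \<sigma> * (fst p - fst q)"
    have x: "fst p = fst q + \<sigma> * k" unfolding k_def \<sigma>_def by auto
    have y: "snd p = snd q - \<tau> * k"
      using that(1) unfolding s_def k_def \<sigma>_def \<tau>_def by (auto split: if_splits)
    have "h p - h q = a * (\<sigma> * k) + b * (\<tau> * k)"
      unfolding h_def x y by (simp add: algebra_simps)
    also have "\<dots> = (\<bar>a\<bar> + \<bar>b\<bar>) * k"
      unfolding \<sigma>_def \<tau>_def by (auto simp: algebra_simps)
    finally have "\<bar>(\<bar>a\<bar> + \<bar>b\<bar>) * k\<bar> < \<bar>a\<bar> + \<bar>b\<bar>" using that by linarith
    then have "(\<bar>a\<bar> + \<bar>b\<bar>) * \<bar>k\<bar> < (\<bar>a\<bar> + \<bar>b\<bar>) * 1" by (simp add: abs_mult)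
    then have "\<bar>k\<bar> < 1" by (rule mult_less_cancel_left_pos[THEN iffD1, rotated]) (use that in linarith)
    then show ?thesis using x y by (simp add: prod_eq_iff)
  qed
  have step: "\<bar>s (P (k + 1)) - s (P k)\<bar> \<le> 1" for k
    using adj[of k] unfolding adj4_def l1dist_def s_def \<sigma>_def \<tau>_def by (auto split: if_splits)
  define lo where "lo = Min (s ` ?S)"
  define hi where "hi = Max (s ` ?S)"
  have fin: "finite (s ` ?S)" and ne: "s ` ?S \<noteq> {}" using True by auto
  obtain u where u: "u \<in> {i..j}" "s (P u) = lo" using Min_in[OF fin ne] unfolding lo_def by auto
  obtain v where v: "v \<in> {i..j}" "s (P v) = hi" using Max_in[OF fin ne] unfolding hi_def by auto
  have s: "lo \<le> s p \<and> s p \<le> hi" if "p \<in> ?S" for p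
    unfolding lo_def hi_def using fin that by simp
  have full: "p \<in> ?S" if p: "lo \<le> s p" "s p \<le> hi" "\<mu> \<le> h p" "h p \<le> ?d" for p
  proof -
    obtain k where k: "k \<in> {i..j}" "s (P k) = s p"
      using int_walk_intermediate_value[of "\<lambda>k. s (P k)", OF step u(1) v(1), of "s p"] u(2) v(2) p by auto
    have "\<mu> \<le> h (P k)" "h (P k) \<le> ?d" using h[OF imageI[OF k(1)]] by blast+
    then have "P k = p" using p(3,4) by (rule determined[OF k(2)])
    then show ?thesis using k(1) by blast
  qed
  have "real (card (cdp_vertices G \<inter> ?S)) \<le> 4 * log 2 (real_of_int (2 * (hi - lo + 1)))"
  proof (rule card_le_box[where s = s and h = h and c = \<mu> and d = ?d])
    show "lo \<le> hi" using s[of "P i"] True by simp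
    fix v w
    assume vw: "v \<in> cdp_vertices G \<inter> ?S" "w \<in> cdp_vertices G \<inter> ?S"
      and b: "lo \<le> 2 * s v - s w" "2 * s v - s w \<le> hi" "\<mu> \<le> 2 * h v - h w" "2 * h v - h w \<le> ?d"
    let ?u = "(2 * fst v - fst w, 2 * snd v - snd w)"
    have "s ?u = 2 * s v - s w" "h ?u = 2 * h v - h w"
      by (simp_all add: s_def h_def algebra_simps)
    \<comment> \<open>A reflection inside the box lies on the segment itself, hence on the
      contour.\<close>
    then have "?u \<in> G" using full[of ?u] b PG by (metis imageE)
    moreover have "w \<in> G" using vw(2) PG by blast
    ultimately show "v = w" using cdp_vertex_reflection vw(1) by blast
  qed (use s h in auto)
  \<comment> \<open>In the grid \<open>s\<close> varies by at most 2m, so the argument is at most 4m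
    + 2 \<le> 8m \<le> m^4, as m \<ge> 2.\<close>
  also have "\<dots> \<le> 4 * log 2 (real m ^ 4)"
  proof -
    obtain tx ty where "\<And>p. p \<in> G \<Longrightarrow> 0 \<le> fst p - tx \<and> fst p - tx \<le> int m \<and>
                                     0 \<le> snd p - ty \<and> snd p - ty \<le> int m"
      using grid unfolding in_grid_def by blast
    from this[OF PG[of u]] this[OF PG[of v]] have "hi - lo \<le> 2 * int m"
      unfolding u(2)[symmetric] v(2)[symmetric] s_def \<sigma>_def \<tau>_def by (auto split: if_splits)
    moreover have "real m ^ 3 \<ge> 2 ^ 3" using m by (intro power_mono) auto
    then have "real m * real m ^ 3 \<ge> real m * 8" by (intro mult_left_mono) auto
    then have "real m ^ 4 \<ge> 8 * real m" by (simp add: power_Suc[symmetric] numeral_eq_Suc)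
    moreover have "lo \<le> hi" using s[of "P i"] True by simp
    ultimately show ?thesis using m by (intro mult_left_mono log_mono) auto
  qed
  also have "\<dots> = 16 * log 2 (real m)" using m by (simp add: log_nat_power)
  finally show ?thesis .
qed

section \<open>Covering a window of the contour by two segments\<close>

lemma window_in_two_DSS:
  assumes min: "\<And>i j. is_maximal_segment P N i j \<Longrightarrow> L \<le> j - i"
    and L: "0 \<le> L" "L < int N"
  obtains y a b \<mu> a' b' \<mu>' where "P ` {x..y} \<subseteq> standard_line a b \<mu>"
    "P ` {y+1..x+L} \<subseteq> standard_line a' b' \<mu>'"
proof -
  \<comment> \<open>Dropping the index conditions of \<open>is_DSS\<close> makes the property pass
    to all subranges, empty ones included.\<close>
  define Q where "Q i j \<longleftrightarrow> (\<exists>a b \<mu>. P ` {i..j} \<subseteq> standard_line a b \<mu>)" for i j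
  have mono: "Q i' j'" if "Q i j" "i \<le> i'" "j' \<le> j" for i j i' j'
  proof -
    have "P ` {i'..j'} \<subseteq> P ` {i..j}" using that by (intro image_mono) auto
    then show ?thesis using that(1) unfolding Q_def by (meson subset_trans)
  qed
  have empty: "Q i j" if "j < i" for i j using that unfolding Q_def by simp
  have single: "Q i i" for i
    unfolding Q_def
    by (intro exI[of _ 1] exI[of _ 0] exI[of _ "fst (P i)"])
      (auto simp: standard_line_def split: prod.split)
  have DSS: "is_DSS P N i j \<longleftrightarrow> i \<le> j \<and> j - i < int N \<and> Q i j" for i j
    unfolding is_DSS_def Q_def by simp
  have greatest: "\<exists>y. p \<le> y \<and> y \<le> q \<and> Q p y \<and> (y = q \<or> \<not> Q p (y + 1))" if "p \<le> q" for p q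
  proof -
    let ?Y = "{y \<in> {p..q}. Q p y}"
    have fin: "finite ?Y" by (rule finite_subset[of _ "{p..q}"]) auto
    have "?Y \<noteq> {}" using single that by auto
    note in_Y = Max_in[OF fin this]
    have "Max ?Y + 1 \<notin> ?Y" using Max_ge[OF fin, of "Max ?Y + 1"] by linarith
    then show ?thesis using in_Y by (intro exI[of _ "Max ?Y"]) auto
  qed
  have "\<exists>y. Q x y \<and> Q (y + 1) (x + L)"
  proof -
    obtain y where y: "x \<le> y" "y \<le> x + L" "Q x y" "y = x + L \<or> \<not> Q x (y + 1)"
      using greatest[of x "x + L"] L by auto
    show ?thesis
    proof (cases "y = x + L")
      case True
      then show ?thesis using y(3) empty by auto
    next
      case False
      then have nQ: "\<not> Q x (y + 1)" using y(4) by blast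
      obtain z where z: "y + 1 \<le> z" "z \<le> x + L" "Q (y + 1) z" "z = x + L \<or> \<not> Q (y + 1) (z + 1)"
        using greatest[of "y + 1" "x + L"] False y(2) by auto
      show ?thesis
      proof (cases "z = x + L")
        case True
        then show ?thesis using y(3) z(3) by blast
      next
        case False
        \<comment> \<open>The second piece stops short at \<open>z\<close>; pull its left end back
          as far as possible. It cannot reach \<open>x\<close>, since the first piece does not
          extend to \<open>y + 1\<close>, so \<open>i - 1\<close> is still in range and its failure
          blocks extension to the left.\<close>
        let ?I = "{i \<in> {x..y+1}. Q i z}"
        define i where "i = Min ?I"
        have fin: "finite ?I" by (rule finite_subset[of _ "{x..y+1}"]) auto
        have "?I \<noteq> {}" using z(3) y(1) by auto
        then have i: "i \<in> ?I" unfolding i_def using Min_in[OF fin] by blast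
        have "i - 1 \<notin> ?I" using Min_le[OF fin, of "i - 1"] unfolding i_def by linarith
        moreover have "i \<noteq> x" using i nQ mono[of x z x "y + 1"] z(1) by auto
        ultimately have "\<not> Q (i - 1) z" "x < i" using i by auto
        \<comment> \<open>An extension to the right would contain the range from
          \<open>y + 1\<close> to \<open>z + 1\<close>, which greedy choice excluded.\<close>
        moreover have "\<not> Q i (z + 1)" using mono[of i "z + 1" "y + 1" "z + 1"] i z(4) False by auto
        ultimately have "is_maximal_segment P N i z"
          unfolding is_maximal_segment_def DSS using i z L by auto
        then have "L \<le> z - i" by (rule min)
        then show ?thesis using z(2) \<open>x < i\<close> by linarith
      qed
    qed
  qed
  then obtain y where y: "Q x y" "Q (y + 1) (x + L)" by blast
  obtain a b \<mu> where "P ` {x..y} \<subseteq> standard_line a b \<mu>" using y(1) unfolding Q_def by blast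
  moreover obtain a' b' \<mu>' where "P ` {y+1..x+L} \<subseteq> standard_line a' b' \<mu>'"
    using y(2) unfolding Q_def by blast
  ultimately show ?thesis by (rule that)
qed

lemma finite_maximal_segment_lengths: "finite {j - i | i j. is_maximal_segment P N i j}"
  by (rule finite_subset[of _ "{0..<int N}"]) (auto simp: is_maximal_segment_def is_DSS_def)

text \<open>A longest DSS is maximal, and lengths are below \<open>N\<close>. Together with
  finiteness this makes the \<open>Min\<close> over maximal segments an attained minimum.\<close>

lemma maximal_segment_exists:
  assumes "N > 0"
  shows "\<exists>i j. is_maximal_segment P N i j"
proof -
  let ?D = "{j - i | i j. is_DSS P N i j}"
  have fin: "finite ?D"
    by (rule finite_subset[of _ "{0..<int N}"]) (auto simp: is_DSS_def)
  have "is_DSS P N 0 0" unfolding is_DSS_def using assms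
    by (intro conjI exI[of _ 1] exI[of _ 0] exI[of _ "fst (P 0)"])
      (auto simp: standard_line_def split: prod.split)
  then have "?D \<noteq> {}" by blast
  then obtain i j where ij: "is_DSS P N i j" "j - i = Max ?D" using Max_in[OF fin] by force
  have "\<not> is_DSS P N i' j'" if "j' - i' > j - i" for i' j'
    using Max_ge[OF fin, of "j' - i'"] ij(2) that by fastforce
  then show ?thesis using ij(1) unfolding is_maximal_segment_def by (intro exI[of _ i] exI[of _ j]) auto
qed

section \<open>Averaging the vertices over windows\<close>

lemma card_vertices_in_window:
  fixes P :: "int \<Rightarrow> pt"
  assumes adj: "\<And>k. adj4 (P k) (P (k + 1))"
    and PG: "\<And>k. P k \<in> G" and grid: "in_grid m G" and m: "m \<ge> 2"
    and min: "\<And>i j. is_maximal_segment P N i j \<Longrightarrow> L \<le> j - i"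
    and L: "0 \<le> L" "L < int N"
  shows "real (card (cdp_vertices G \<inter> P ` {x..x+L})) \<le> 32 * log 2 (real m)"
proof -
  obtain y a b \<mu> a' b' \<mu>' where y: "P ` {x..y} \<subseteq> standard_line a b \<mu>"
    "P ` {y+1..x+L} \<subseteq> standard_line a' b' \<mu>'"
    using window_in_two_DSS[OF min L] by metis
  let ?A = "\<lambda>p q. cdp_vertices G \<inter> P ` {p..q}"
  have "{x..x+L} \<subseteq> {x..y} \<union> {y+1..x+L}" by auto
  then have "?A x (x+L) \<subseteq> ?A x y \<union> ?A (y+1) (x+L)" by blast
  then have "card (?A x (x+L)) \<le> card (?A x y \<union> ?A (y+1) (x+L))"
    by (intro card_mono) auto
  also have "\<dots> \<le> card (?A x y) + card (?A (y+1) (x+L))" by (rule card_Un_le)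
  finally show ?thesis
    using card_vertices_on_DSS[OF adj PG grid m y(1)] card_vertices_on_DSS[OF adj PG grid m y(2)]
    by linarith
qed

lemma min_maximal_segment_bound:
  assumes m: "m \<ge> 2" and grid: "in_grid m G" and e: "n_e G \<ge> 1" and contour: "is_contour G P N V t"
  shows "real_of_int (Min {j - i | i j. is_maximal_segment P N i j})
      \<le> 64 / ln 2 * ln (real m) * real_of_int (per_contour (n_e G) t) / real (n_e G)"
proof -
  let ?e = "n_e G"
  define L where "L = Min {j - i | i j. is_maximal_segment P N i j}"
  define K where "K = 32 * log 2 (real m)"
  have N: "N > 0" and periodic: "\<And>i. P (i + int N) = P i" and adj: "\<And>k. adj4 (P k) (P (k + 1))"
    and image: "P ` {0..<int N} = boundary_pts G" and V: "bij_betw V {..<?e} (cdp_vertices G)"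
    and te: "t ?e = t 0 + int N" and tless: "\<And>k. k < ?e \<Longrightarrow> t k < t (Suc k)"
    and PV: "\<And>k. k < ?e \<Longrightarrow> P (t k) = V k"
    using contour unfolding is_contour_def Let_def by auto
  \<comment> \<open>This is needed for all integers \<open>k\<close>: the last window may run past
    the end of the period.\<close>
  have PG: "P k \<in> G" for k
  proof -
    interpret periodic_fun_simple P "int N" by standard (rule periodic)
    have "P k = P (k mod int N + of_int (k div int N) * int N)" by simp
    also have "\<dots> = P (k mod int N)" by (rule plus_of_int)
    also have "\<dots> \<in> boundary_pts G" unfolding image[symmetric] using N by (intro imageI) simp
    finally show ?thesis by (simp add: boundary_pts_def)
  qed
  have ne: "{j - i | i j. is_maximal_segment P N i j} \<noteq> {}" using maximal_segment_exists[OF N] by blast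
  have "L \<in> {j - i | i j. is_maximal_segment P N i j}"
    unfolding L_def by (rule Min_in[OF finite_maximal_segment_lengths ne])
  then have L: "0 \<le> L" "L < int N" by (auto simp: is_maximal_segment_def is_DSS_def)
  have min: "L \<le> j - i" if "is_maximal_segment P N i j" for i j
    unfolding L_def using that by (intro Min_le finite_maximal_segment_lengths) blast
  have mono_t: "t k \<le> t l" if "k \<le> l" "l \<le> ?e" for k l
    using that
  proof (induction rule: dec_induct)
    case (step n)
    then show ?case using tless[of n] by simp
  qed simp
  have per: "per_contour ?e t = int N"
    unfolding per_contour_def using te by (simp add: sum_lessThan_telescope)
  \<comment> \<open>A window from \<open>x\<close> to \<open>x + L\<close> has \<open>L + 1\<close>
    indices. The period starting at \<open>t 0\<close> is cut into such windows, numbered from 0 to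
    \<open>B\<close>; \<open>idx k\<close> is the one containing \<open>t k\<close>.\<close>
  define w where "w = L + 1"
  define idx where "idx k = (t k - t 0) div w" for k
  define B where "B = (int N - 1) div w"
  have w: "0 < w" "w \<le> int N" using L by (auto simp: w_def)
  have idx: "idx ` {..<?e} \<subseteq> {0..B}"
  proof safe
    fix k assume k: "k < ?e"
    have "t 0 \<le> t k" "t k \<le> t 0 + int N - 1"
      using mono_t[of 0 k] mono_t[of "Suc k" ?e] tless[of k] te k by auto
    then show "idx k \<in> {0..B}"
      unfolding idx_def B_def using w by (auto intro!: zdiv_mono1 simp: pos_imp_zdiv_nonneg_iff)
  qed
  have fiber: "real (card {k \<in> {..<?e}. idx k = r}) \<le> K" for r
  proof -
    let ?F = "{k \<in> {..<?e}. idx k = r}" and ?x = "t 0 + r * w"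
    have "V ` ?F \<subseteq> cdp_vertices G \<inter> P ` {?x..?x+L}"
    proof
      fix v assume "v \<in> V ` ?F"
      then obtain k where k: "k < ?e" "idx k = r" "v = V k" by auto
      have "v \<in> cdp_vertices G" using V k(1,3) by (auto simp: bij_betw_def)
      moreover have "(t k - t 0) = r * w + (t k - t 0) mod w" unfolding k(2)[symmetric] idx_def by simp
      moreover have "0 \<le> (t k - t 0) mod w" "(t k - t 0) mod w < w" using w by simp_all
      ultimately have "t k \<in> {?x..?x+L}"
        unfolding atLeastAtMost_iff w_def by linarith
      then have "v \<in> P ` {?x..?x+L}" using PV[OF k(1)] k(3) by (metis imageI)
      with \<open>v \<in> cdp_vertices G\<close> show "v \<in> cdp_vertices G \<inter> P ` {?x..?x+L}" by blast
    qed
    then have "card (V ` ?F) \<le> card (cdp_vertices G \<inter> P ` {?x..?x+L})" by (intro card_mono) auto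
    moreover have "card (V ` ?F) = card ?F"
      using V by (intro card_image) (auto simp: bij_betw_def inj_on_def)
    ultimately show ?thesis
      using card_vertices_in_window[where P = P, OF adj PG grid m min L, of ?x] unfolding K_def by linarith
  qed
  have "real ?e = (\<Sum>r\<in>{0..B}. real (card {k \<in> {..<?e}. idx k = r}))"
    using sum.group[of "{..<?e}" "{0..B}" idx "\<lambda>_. 1 :: real"] idx by simp
  also have "\<dots> \<le> (\<Sum>r\<in>{0..B}. K)" by (rule sum_mono) (rule fiber)
  also have "\<dots> = real_of_int (B + 1) * K"
  proof -
    have "0 \<le> B" unfolding B_def using w N by (simp add: pos_imp_zdiv_nonneg_iff)
    then show ?thesis by simp
  qed
  finally have "real ?e * real_of_int w \<le> real_of_int ((B + 1) * w) * K"
    using w by (simp add: mult.commute mult.left_commute)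
  \<comment> \<open>The incomplete last window costs at most one extra \<open>w\<close>, and
    \<open>w \<le> N\<close>.\<close>
  also have "\<dots> \<le> real_of_int (2 * int N) * K"
  proof (intro mult_right_mono)
    have "B * w \<le> int N - 1" unfolding B_def using w
      by (metis minus_mod_eq_div_mult pos_mod_sign diff_left_mono diff_zero)
    then show "real_of_int ((B + 1) * w) \<le> real_of_int (2 * int N)"
      using w by (simp only: of_int_le_iff) (simp add: algebra_simps)
    show "0 \<le> K" unfolding K_def using m by simp
  qed
  finally have "real_of_int w \<le> 2 * K * real N / real ?e"
    using e by (simp add: field_simps)
  \<comment> \<open>Since \<open>L < w\<close>, the constant is twice the 32 in \<open>K\<close>,
    divided by \<open>ln 2\<close> to change the base of the logarithm.\<close>
  then show ?thesis
    unfolding L_def[symmetric] per w_def K_def log_def by (simp add: algebra_simps)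
qed

theorem theorem4:
  shows "\<exists>c>0. \<forall>(m::nat) G P N V t.
    m \<ge> 2 \<longrightarrow> cdp G \<longrightarrow> in_grid m G \<longrightarrow> n_e G \<ge> 1 \<longrightarrow> is_contour G P N V t \<longrightarrow>
    real_of_int (Min {j - i | i j. is_maximal_segment P N i j})
      \<le> c * ln (real m) * real_of_int (per_contour (n_e G) t) / real (n_e G)"
proof (intro exI[of _ "64 / ln 2"] conjI allI impI)
  show "0 < 64 / ln (2::real)" by simp
next
  fix m G P N V t
  assume "2 \<le> m" "in_grid m G" "1 \<le> n_e G" "is_contour G P N V t"
  then show "real_of_int (Min {j - i | i j. is_maximal_segment P N i j})
      \<le> 64 / ln 2 * ln (real m) * real_of_int (per_contour (n_e G) t) / real (n_e G)"
    by (rule min_maximal_segment_bound)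
qed

end
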